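(* Let $n\ge 1$, let $H\in\mathbb{R}^{n\times n}$ be symmetric with minimum eigenvalue $\lambda_1$, and let $c\in\mathbb{R}^n$. Consider $$(\mathrm{TRS})\quad \min\left\{\tfrac12 x^THx+c^Tx:\ x\in\mathbb{R}^n,\ x^Tx\le 1\right\}$$ and $$(\mathrm{D})\quad \min\left\{\tfrac12 x^THx+\tfrac12 y^THy+c^Tx:\ (x,y)\in\mathbb{R}^n\times\mathbb{R}^n,\ x^Tx+y^Ty\le 1\right\}.$$ Then the optimal values of (TRS) and (D) are equal. Moreover, let $(\tilde x,\tilde y)$ be a global minimizer of (D). Then: (i) if $\tilde y=0$, then $x^*=\tilde x$ is a global minimizer of (TRS); (ii) if $\tilde y\ne 0$, then "hard case (ii)" holds for (TRS), and $$x^*=\tilde x+\frac{\sqrt{(\tilde x^T\tilde y)^2+\tilde y^T\tilde y\,(1-\tilde x^T\tilde x)}-\tilde x^T\tilde y}{\tilde y^T\tilde y}\,\tilde y$$ is a global minimizer of (TRS).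
   Context: For any global minimizer $x$ of (TRS) there is a unique $\lambda^*\ge 0$ such that $(H+\lambda^*I)x+c=0$ and $\lambda^*(x^Tx-1)=0$ ($\lambda^*/2$ is the KKT multiplier corresponding to the global minimizer; it is the same for all global minimizers). "Hard case (ii)" for (TRS) means: $c\in\mathrm{Range}(H-\lambda_1I)$, $\lambda^*=-\lambda_1$, and $\|(H-\lambda_1I)^\dagger c\|<1$, where $\dagger$ denotes the Moore–Penrose pseudoinverse, $\mathrm{Range}$ the column space, and $\|\cdot\|$ the Euclidean norm. *)

theory Defs
  imports "HOL-Analysis.Analysis"
begin

definition eigenvalue :: "real^'n^'n \<Rightarrow> real \<Rightarrow> bool" where
  "eigenvalue A l \<longleftrightarrow> (\<exists>v. v \<noteq> 0 \<and> A *v v = l *\<^sub>R v)"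

definition min_eigenvalue :: "real^'n^'n \<Rightarrow> real" where
  "min_eigenvalue A = (LEAST l. eigenvalue A l)"

definition is_pseudoinverse :: "real^'n^'m \<Rightarrow> real^'m^'n \<Rightarrow> bool" where
  "is_pseudoinverse A X \<longleftrightarrow>
     A ** X ** A = A \<and> X ** A ** X = X \<and>
     transpose (A ** X) = A ** X \<and> transpose (X ** A) = X ** A"

definition pseudoinverse :: "real^'n^'m \<Rightarrow> real^'m^'n" where
  "pseudoinverse A = (THE X. is_pseudoinverse A X)"

lemma is_pseudoinverse_unique:
  assumes "is_pseudoinverse A X" "is_pseudoinverse A Y"
  shows "X = Y"
proof -
  have X: "A ** X ** A = A" "X ** A ** X = X" "transpose (A ** X) = A ** X" "transpose (X ** A) = X ** A"
    and Y: "A ** Y ** A = A" "Y ** A ** Y = Y" "transpose (A ** Y) = A ** Y" "transpose (Y ** A) = Y ** A"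
    using assms by (auto simp: is_pseudoinverse_def)
  have "A ** X = transpose (A ** Y ** (A ** X))"
    using X(3) Y(1) by (metis matrix_mul_assoc)
  also have "\<dots> = A ** X ** (A ** Y)"
    by (simp only: matrix_transpose_mul[of "A ** Y" "A ** X"] X(3) Y(3))
  also have "\<dots> = A ** Y"
    by (simp add: matrix_mul_assoc X(1))
  finally have AX: "A ** X = A ** Y" .
  have "X ** A = transpose (X ** A ** (Y ** A))"
    using X(4) Y(1) by (metis matrix_mul_assoc)
  also have "\<dots> = Y ** A ** (X ** A)"
    by (simp only: matrix_transpose_mul[of "X ** A" "Y ** A"] X(4) Y(4))
  also have "\<dots> = Y ** A"
    by (metis X(1) matrix_mul_assoc)
  finally have XA: "X ** A = Y ** A" .
  show ?thesis
    using AX XA X(2) Y(2) by (metis matrix_mul_assoc)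
qed

lemma is_pseudoinverse_exists: "\<exists>X. is_pseudoinverse (A :: real^'n^'m) X"
proof -
  let ?R = "span (rows A)"
  let ?T = "transpose A"
  have TA: "(?T *v u) \<bullet> w = u \<bullet> (A *v w)" for u w
    by (simp add: dot_lmul_matrix)
  have null: "A *v x = 0" if "?T *v (A *v x) = 0" for x
    using TA[of "A *v x" x] that by simp
  have ex: "\<exists>x \<in> ?R. ?T *v (A *v x) = ?T *v b" for b
  proof -
    obtain y z where y: "y \<in> span (columns A)"
      and z: "\<And>w. w \<in> span (columns A) \<Longrightarrow> orthogonal z w" and b: "b = y + z"
      using orthogonal_subspace_decomp_exists[of "columns A" b] by metis
    have "(?T *v z) \<bullet> (?T *v z) = 0"
      using z[OF matrix_vector_mult_in_columnspace[of A "?T *v z"]]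
      unfolding TA orthogonal_def .
    then have "?T *v z = 0" by simp
    then have Tb: "?T *v b = ?T *v y"
      unfolding b by (simp only: matrix_vector_right_distrib add_0_right)
    have "subspace (range ((*v) A))"
      by (simp add: linear_subspace_image)
    moreover have "columns A \<subseteq> range ((*v) A)"
      by (metis (no_types, lifting) columns_image_basis image_mono subset_UNIV)
    ultimately have "y \<in> range ((*v) A)"
      using y span_minimal by blast
    then obtain x where x: "y = A *v x" by auto
    obtain p q where p: "p \<in> ?R" and q: "\<And>w. w \<in> ?R \<Longrightarrow> orthogonal q w" and xpq: "x = p + q"
      using orthogonal_subspace_decomp_exists[of "rows A" x] by metis
    have "?T *v (A *v q) \<in> ?R"
      using matrix_vector_mult_in_columnspace[of ?T "A *v q"] by (simp only: columns_transpose)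
    then have "(A *v q) \<bullet> (A *v q) = 0"
      using q unfolding TA[symmetric] orthogonal_def by (metis inner_commute)
    then have "A *v x = A *v p"
      unfolding xpq by (simp add: matrix_vector_right_distrib)
    then show ?thesis using p Tb x by metis
  qed
  have uniq: "x = y"
    if "x \<in> ?R" "y \<in> ?R" "?T *v (A *v x) = ?T *v (A *v y)" for x y
  proof -
    have "A *v (x - y) = 0"
      using that(3) by (intro null) (simp only: matrix_vector_mult_diff_distrib diff_self)
    then show ?thesis
      using that(1,2) matrix_vector_mul_injective_on_rowspace[of A x y]
      by (simp add: matrix_vector_mult_diff_distrib)
  qed
  obtain g where gR: "\<And>b. g b \<in> ?R" and g: "\<And>b. ?T *v (A *v g b) = ?T *v b"
    using ex by metis
  have "linear g"
  proof (rule linearI)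
    show "g (a + b) = g a + g b" for a b
      by (rule uniq[OF gR span_add[OF gR gR]])
         (simp only: matrix_vector_right_distrib g)
    show "g (r *\<^sub>R a) = r *\<^sub>R g a" for r a
      by (rule uniq[OF gR span_scale[OF gR]])
         (simp only: matrix_vector_mult_scaleR g)
  qed
  then have X: "matrix g *v b = g b" for b
    by (simp add: matrix_works)
  have AgA: "A *v g (A *v x) = A *v x" for x
  proof -
    have "A *v (g (A *v x) - x) = 0"
      by (rule null) (simp only: matrix_vector_mult_diff_distrib g diff_self)
    then show ?thesis by (simp add: matrix_vector_mult_diff_distrib)
  qed
  have gAg: "g (A *v g b) = g b" for b
    by (rule uniq[OF gR gR]) (simp only: AgA)
  have s1: "(A *v g u) \<bullet> v = (A *v g u) \<bullet> (A *v g v)" for u v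
    by (metis TA g inner_commute)
  have s2: "g (A *v u) \<bullet> v = g (A *v u) \<bullet> g (A *v v)" for u v
    using orthogonal_nullspace_rowspace[of A "g (A *v v) - v" "g (A *v u)"] gR
    by (simp add: matrix_vector_mult_diff_distrib AgA orthogonal_def inner_diff_left inner_diff_right inner_commute)
  have sym: "transpose M = M" if "\<And>u v. (M *v u) \<bullet> v = u \<bullet> (M *v v)" for M :: "real^'k^'k"
  proof -
    have "(\<lambda>u. transpose M *v u) = (\<lambda>u. M *v u)"
      using adjoint_unique[of "(*v) M" "(*v) M"] that adjoint_matrix[of M] by simp
    then show ?thesis by (metis matrix_eq)
  qed
  have "is_pseudoinverse A (matrix g)"
    unfolding is_pseudoinverse_def
  proof (intro conjI)
    show "A ** matrix g ** A = A"
      by (simp add: matrix_eq matrix_vector_mul_assoc[symmetric] X AgA)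
    show "matrix g ** A ** matrix g = matrix g"
      by (simp add: matrix_eq matrix_vector_mul_assoc[symmetric] X gAg)
    show "transpose (A ** matrix g) = A ** matrix g"
      by (rule sym, simp only: matrix_vector_mul_assoc[symmetric] X) (metis s1 inner_commute)
    show "transpose (matrix g ** A) = matrix g ** A"
      by (rule sym, simp only: matrix_vector_mul_assoc[symmetric] X) (metis s2 inner_commute)
  qed
  then show ?thesis ..
qed

lemma is_pseudoinverse_pseudoinverse: "is_pseudoinverse A (pseudoinverse A)"
  unfolding pseudoinverse_def
  using is_pseudoinverse_exists is_pseudoinverse_unique by (metis theI')

definition trs_obj :: "real^'n^'n \<Rightarrow> real^'n \<Rightarrow> real^'n \<Rightarrow> real" where
  "trs_obj H c x = 1/2 * (x \<bullet> (H *v x)) + c \<bullet> x"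

definition trs_feasible :: "real^'n \<Rightarrow> bool" where
  "trs_feasible x \<longleftrightarrow> x \<bullet> x \<le> 1"

definition d_obj :: "real^'n^'n \<Rightarrow> real^'n \<Rightarrow> (real^'n) \<times> (real^'n) \<Rightarrow> real" where
  "d_obj H c = (\<lambda>(x, y). 1/2 * (x \<bullet> (H *v x)) + 1/2 * (y \<bullet> (H *v y)) + c \<bullet> x)"

definition d_feasible :: "(real^'n) \<times> (real^'n) \<Rightarrow> bool" where
  "d_feasible = (\<lambda>(x, y). x \<bullet> x + y \<bullet> y \<le> 1)"

definition trs_minimizer :: "real^'n^'n \<Rightarrow> real^'n \<Rightarrow> real^'n \<Rightarrow> bool" where
  "trs_minimizer H c = is_arg_min (trs_obj H c) trs_feasible"

definition d_minimizer :: "real^'n^'n \<Rightarrow> real^'n \<Rightarrow> (real^'n) \<times> (real^'n) \<Rightarrow> bool" where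
  "d_minimizer H c = is_arg_min (d_obj H c) d_feasible"

(* The feasible sets are nonempty and compact, so both infima are attained minima. *)

definition trs_value :: "real^'n^'n \<Rightarrow> real^'n \<Rightarrow> real" where
  "trs_value H c = (INF x \<in> Collect trs_feasible. trs_obj H c x)"

definition d_value :: "real^'n^'n \<Rightarrow> real^'n \<Rightarrow> real" where
  "d_value H c = (INF z \<in> Collect d_feasible. d_obj H c z)"

(* Twice the KKT multiplier.  Minimizers exist, each determines l uniquely, and
   for symmetric H the value l is the same for all of them. *)
definition lambda_star :: "real^'n^'n \<Rightarrow> real^'n \<Rightarrow> real" where
  "lambda_star H c = (THE l. 0 \<le> l \<and>
     (\<forall>x. trs_minimizer H c x \<longrightarrow> (H + mat l) *v x + c = 0 \<and> l * (x \<bullet> x - 1) = 0))"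

definition hard_case_ii :: "real^'n^'n \<Rightarrow> real^'n \<Rightarrow> bool" where
  "hard_case_ii H c \<longleftrightarrow>
     c \<in> span (columns (H - mat (min_eigenvalue H))) \<and>
     lambda_star H c = - min_eigenvalue H \<and>
     norm (pseudoinverse (H - mat (min_eigenvalue H)) *v c) < 1"

end

theory Submission
  imports Defs
begin

text \<open>
  For fixed \<open>x\<close>, the variable \<open>y\<close> of (D) minimizes the form \<open>y \<bullet> H y\<close> over a ball. If
  \<open>y \<noteq> 0\<close> is optimal, then the least eigenvalue \<open>l\<close> is nonpositive, \<open>y\<close> is an eigenvector for
  \<open>l\<close>, and \<open>l * (x \<bullet> x + y \<bullet> y - 1) = 0\<close>. Eliminating \<open>y\<close> then leaves the convex quadratic with matrix
  \<open>H - l I\<close>, minimized over the unit ball at the interior point \<open>x\<close>, so \<open>(H - l I) x + c = 0\<close>. Hence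
  \<open>-l\<close> is a multiplier with \<open>H - l I\<close> positive semidefinite, from which hard case (ii) follows.

  The optimal values agree because the line \<open>x + t y\<close> meets the sphere of squared radius
  \<open>x \<bullet> x + y \<bullet> y\<close> at parameters \<open>t\<^sub>1 > 0 > t\<^sub>2\<close> with \<open>t\<^sub>1 t\<^sub>2 = -1\<close>. In the average with mean zero, \<open>t\<^sup>2\<close>
  has mean one, so at one of the two points the objective is at most that of \<open>(x, y)\<close> in (D).
\<close>

section \<open>Shifted matrices and the expansion of the objective along a line\<close>

lemma mat_vector_mult: "(mat k :: real^'n^'n) *v x = k *\<^sub>R x"
  by (simp add: vec_eq_iff matrix_vector_mult_def mat_def if_distrib if_distribR cong: if_cong)

lemma add_mat_vector_mult: "((H :: real^'n^'n) + mat k) *v x = H *v x + k *\<^sub>R x"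
  by (simp add: matrix_vector_mult_add_rdistrib mat_vector_mult)

lemma diff_mat_vector_mult: "((H :: real^'n^'n) - mat k) *v x = H *v x - k *\<^sub>R x"
  by (simp add: matrix_vector_mult_diff_rdistrib mat_vector_mult)

lemma transpose_diff_mat:
  "transpose H = H \<Longrightarrow> transpose (H - mat k) = H - mat (k :: real)"
  by (simp add: vec_eq_iff transpose_def mat_def)

lemma symmetric_inner_commute:
  fixes M :: "real^'n^'n"
  assumes "transpose M = M"
  shows "x \<bullet> (M *v y) = y \<bullet> (M *v x)"
  by (metis assms dot_lmul_matrix inner_commute vector_transpose_matrix)

lemma trs_obj_add_scaleR:
  fixes M :: "real^'n^'n"
  assumes "transpose M = M"
  shows "trs_obj M c (x + t *\<^sub>R d)
    = trs_obj M c x + t * ((M *v x + c) \<bullet> d) + t\<^sup>2 * (1/2 * (d \<bullet> (M *v d)))"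
  using symmetric_inner_commute[OF assms, of x d]
  by (simp add: trs_obj_def matrix_vector_right_distrib matrix_vector_mult_scaleR inner_simps
      inner_commute power2_eq_square algebra_simps)

lemma trs_obj_diff_mat:
  "trs_obj (H - mat k) c x = trs_obj H c x - 1/2 * k * (x \<bullet> x)"
  by (simp add: trs_obj_def diff_mat_vector_mult inner_diff_right right_diff_distrib)

lemma d_obj_eq: "d_obj H c (x, y) = trs_obj H c x + 1/2 * (y \<bullet> (H *v y))"
  by (simp add: d_obj_def trs_obj_def)

lemma trs_minimizer_iff:
  "trs_minimizer H c x \<longleftrightarrow> x \<bullet> x \<le> 1 \<and> (\<forall>z. z \<bullet> z \<le> 1 \<longrightarrow> trs_obj H c x \<le> trs_obj H c z)"
  by (auto simp: trs_minimizer_def is_arg_min_linorder trs_feasible_def)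

lemma d_minimizer_iff:
  "d_minimizer H c (x, y) \<longleftrightarrow> x \<bullet> x + y \<bullet> y \<le> 1 \<and>
    (\<forall>u v. u \<bullet> u + v \<bullet> v \<le> 1 \<longrightarrow> d_obj H c (x, y) \<le> d_obj H c (u, v))"
  by (auto simp: d_minimizer_def is_arg_min_linorder d_feasible_def)

section \<open>Stationarity and the Rayleigh bound\<close>

lemma trs_obj_local_min_imp_stationary:
  fixes M :: "real^'n^'n"
  assumes sym: "transpose M = M" and e: "0 < e"
    and min: "\<And>z. z \<in> ball x e \<Longrightarrow> trs_obj M c x \<le> trs_obj M c z"
  shows "M *v x + c = 0"
proof (rule ccontr)
  \<comment> \<open>The test direction is the gradient itself, so the slope at 0 is
    \<open>d \<bullet> d\<close>, which a local minimum forces to vanish.\<close>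
  define d where "d = M *v x + c"
  assume "M *v x + c \<noteq> 0"
  then have d: "0 < norm d" by (simp add: d_def)
  define f where "f t = trs_obj M c (x + t *\<^sub>R d)" for t
  have f: "f t = trs_obj M c x + t * (d \<bullet> d) + t\<^sup>2 * (1/2 * (d \<bullet> (M *v d)))" for t
    by (simp add: f_def d_def trs_obj_add_scaleR[OF sym])
  have "(f has_real_derivative d \<bullet> d) (at 0)"
    unfolding f by (auto intro!: derivative_eq_intros)
  moreover have "\<forall>t. \<bar>0 - t\<bar> < e / norm d \<longrightarrow> f 0 \<le> f t"
    using min d by (auto simp: f_def dist_norm pos_less_divide_eq)
  ultimately have "d \<bullet> d = 0"
    using DERIV_local_min e d by (metis divide_pos_pos)
  then show False using d by simp
qed

text \<open>Such a \<open>v\<close> is a global minimizer of the quadratic form, so the gradient of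
  the form vanishes there.\<close>

lemma psd_inner_eq_0_imp:
  fixes M :: "real^'n^'n"
  assumes "transpose M = M" "\<And>x. 0 \<le> x \<bullet> (M *v x)" "v \<bullet> (M *v v) = 0"
  shows "M *v v = 0"
  using trs_obj_local_min_imp_stationary[OF assms(1), of 1 v 0] assms(2,3)
  by (simp add: trs_obj_def)

text \<open>By compactness the form attains a minimum \<open>m\<close> on the unit sphere. Then
  \<open>H - mat m\<close> is positive semidefinite and its form vanishes at the minimizer, which is
  therefore an eigenvector. This also shows that the \<open>LEAST\<close> in
  \<open>min_eigenvalue\<close> is attained.\<close>

lemma min_eigenvalue_Rayleigh:
  fixes H :: "real^'n^'n"
  assumes sym: "transpose H = H"
  shows "eigenvalue H (min_eigenvalue H)" "min_eigenvalue H * (x \<bullet> x) \<le> x \<bullet> (H *v x)"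
proof -
  have "continuous_on (sphere 0 1) (\<lambda>x. x \<bullet> (H *v x))"
    by (intro continuous_intros matrix_vector_mult_linear_continuous_on)
  then obtain v where v: "norm v = 1" and min: "\<And>u. norm u = 1 \<Longrightarrow> v \<bullet> (H *v v) \<le> u \<bullet> (H *v u)"
    using continuous_attains_inf[of "sphere (0 :: real^'n) 1" "\<lambda>x. x \<bullet> (H *v x)"] by force
  define m where "m = v \<bullet> (H *v v)"
  have m: "m * (x \<bullet> x) \<le> x \<bullet> (H *v x)" for x
  proof (cases "x = 0")
    case False
    then have "m \<le> sgn x \<bullet> (H *v sgn x)"
      using min by (simp add: m_def norm_sgn)
    also have "\<dots> = x \<bullet> (H *v x) / (x \<bullet> x)"
      by (simp add: sgn_div_norm matrix_vector_mult_scaleR dot_square_norm power2_eq_square divide_simps)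
    finally show ?thesis
      using False by (simp add: pos_le_divide_eq)
  qed simp
  have "(H - mat m) *v v = 0"
  proof (rule psd_inner_eq_0_imp[OF transpose_diff_mat[OF sym]])
    show "0 \<le> x \<bullet> ((H - mat m) *v x)" for x
      using m[of x] by (simp add: diff_mat_vector_mult inner_simps)
    show "v \<bullet> ((H - mat m) *v v) = 0"
      using v by (simp add: diff_mat_vector_mult inner_simps m_def dot_square_norm)
  qed
  then have eig: "eigenvalue H m"
    using v by (auto simp: eigenvalue_def diff_mat_vector_mult intro!: exI[of _ v])
  have "m \<le> l" if "eigenvalue H l" for l
  proof -
    obtain u where "u \<noteq> 0" "H *v u = l *\<^sub>R u"
      using \<open>eigenvalue H l\<close> by (auto simp: eigenvalue_def)
    then show ?thesis using m[of u] by simp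
  qed
  then have "min_eigenvalue H = m"
    unfolding min_eigenvalue_def using eig by (rule Least_equality[rotated])
  then show "eigenvalue H (min_eigenvalue H)" "min_eigenvalue H * (x \<bullet> x) \<le> x \<bullet> (H *v x)"
    using eig m by simp_all
qed

section \<open>Existence of minimizers and equality of the optimal values\<close>

lemma ex_trs_minimizer: "\<exists>x. trs_minimizer H c x"
proof -
  have "continuous_on (cball 0 1) (trs_obj H c)"
    unfolding trs_obj_def
    by (intro continuous_intros matrix_vector_mult_linear_continuous_on)
  then obtain x where "x \<in> cball 0 1" "\<forall>z\<in>cball 0 1. trs_obj H c x \<le> trs_obj H c z"
    using continuous_attains_inf[of "cball 0 1" "trs_obj H c"] by auto
  then show ?thesis
    by (auto simp: trs_minimizer_iff norm_le_square)
qed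

lemma trs_obj_le_d_obj:
  fixes H :: "real^'n^'n"
  assumes sym: "transpose H = H"
  shows "\<exists>z. z \<bullet> z = x \<bullet> x + y \<bullet> y \<and> trs_obj H c z \<le> d_obj H c (x, y)"
proof (cases "y = 0")
  case True
  then show ?thesis by (auto simp: d_obj_eq)
next
  case False
  define a b s g q where "a = y \<bullet> y" and "b = x \<bullet> y" and "s = sqrt (b\<^sup>2 + a\<^sup>2)"
    and "g = (H *v x + c) \<bullet> y" and "q = 1/2 * (y \<bullet> (H *v y))"
  have a: "0 < a" using False by (simp add: a_def)
  have s2: "s\<^sup>2 = b\<^sup>2 + a\<^sup>2" by (simp add: s_def)
  have s: "\<bar>b\<bar> < s"
    unfolding s_def using a by (intro real_less_rsqrt) simp
  \<comment> \<open>The two roots of \<open>a * t\<^sup>2 + 2 * b * t = a\<close>, where the line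
    meets the sphere.\<close>
  define t1 t2 where "t1 = (s - b) / a" and "t2 = (- s - b) / a"
  have t: "t2 < 0" "0 < t1"
    using a s by (auto simp: t1_def t2_def field_simps)
  have prod: "t1 * t2 = -1"
    using a s2 by (simp add: t1_def t2_def field_simps power2_eq_square)
  have norm: "(x + t *\<^sub>R y) \<bullet> (x + t *\<^sub>R y) = x \<bullet> x + 2 * t * b + t\<^sup>2 * a" for t
    by (simp add: a_def b_def inner_simps inner_commute power2_eq_square algebra_simps)
  have root: "2 * t * b + t\<^sup>2 * a = a" if "t = t1 \<or> t = t2" for t
  proof -
    have "(a * t + b)\<^sup>2 = s\<^sup>2"
      using that a by (auto simp: t1_def t2_def power2_eq_square)
    then have "a * (2 * t * b + t\<^sup>2 * a) = a * a"
      unfolding s2 by (simp add: power2_eq_square algebra_simps)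
    then show ?thesis using a by simp
  qed
  \<comment> \<open>Relative to \<open>trs_obj H c x\<close>, moving by \<open>t\<close> adds
    \<open>t * g + t\<^sup>2 * q\<close>, while the \<open>y\<close> block of (D) adds
    \<open>q\<close>.\<close>
  have "t1 * g + t1\<^sup>2 * q \<le> q \<or> t2 * g + t2\<^sup>2 * q \<le> q"
  proof (rule ccontr)
    assume "\<not> ?thesis"
    \<comment> \<open>The positive weights \<open>- t2\<close> and \<open>t1\<close> cancel the
      terms in \<open>g\<close>; \<open>t1 * t2 = -1\<close> then cancels those in
      \<open>q\<close>.\<close>
    then have "0 < (- t2) * (t1 * g + t1\<^sup>2 * q - q) + t1 * (t2 * g + t2\<^sup>2 * q - q)"
      using t by (intro add_pos_pos mult_pos_pos) auto
    also have "\<dots> = - (t1 * t2 + 1) * (t1 - t2) * q"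
      by (simp add: power2_eq_square algebra_simps)
    finally show False using prod by simp
  qed
  then obtain t where "t = t1 \<or> t = t2" "t * g + t\<^sup>2 * q \<le> q" by blast
  then have "(x + t *\<^sub>R y) \<bullet> (x + t *\<^sub>R y) = x \<bullet> x + y \<bullet> y"
    "trs_obj H c (x + t *\<^sub>R y) \<le> d_obj H c (x, y)"
    using root[of t]
    by (auto simp: norm trs_obj_add_scaleR[OF sym] d_obj_eq g_def q_def simp flip: a_def)
  then show ?thesis by blast
qed

text \<open>Every feasible pair is dominated by a feasible point of (TRS). The backward direction
  supplies a minimizer of (D) from one of (TRS).\<close>

lemma d_minimizer_0_iff:
  assumes "transpose H = H"
  shows "d_minimizer H c (x, 0) \<longleftrightarrow> trs_minimizer H c x"
proof
  assume "d_minimizer H c (x, 0)"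
  then show "trs_minimizer H c x"
    unfolding d_minimizer_iff trs_minimizer_iff
    by (metis add.right_neutral d_obj_eq inner_zero_left mult_zero_right)
next
  assume x: "trs_minimizer H c x"
  have "d_obj H c (x, 0) \<le> d_obj H c (u, v)" if "u \<bullet> u + v \<bullet> v \<le> 1" for u v
  proof -
    obtain z where "z \<bullet> z = u \<bullet> u + v \<bullet> v" "trs_obj H c z \<le> d_obj H c (u, v)"
      using trs_obj_le_d_obj[OF assms] by blast
    moreover from this(1) have "trs_obj H c x \<le> trs_obj H c z"
      using x that by (simp add: trs_minimizer_iff)
    ultimately show ?thesis by (simp add: d_obj_eq)
  qed
  then show "d_minimizer H c (x, 0)"
    using x by (simp add: d_minimizer_iff trs_minimizer_iff)
qed

lemma trs_value_eq: "trs_minimizer H c x \<Longrightarrow> trs_value H c = trs_obj H c x"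
  unfolding trs_value_def
  by (intro cInf_eq_minimum) (auto simp: trs_minimizer_iff trs_feasible_def)

lemma d_value_eq: "d_minimizer H c z \<Longrightarrow> d_value H c = d_obj H c z"
  unfolding d_value_def
  by (intro cInf_eq_minimum) (auto simp: d_minimizer_def is_arg_min_linorder)

lemma trs_value_eq_d_value:
  assumes "transpose H = H"
  shows "trs_value H c = d_value H c"
proof -
  obtain x where x: "trs_minimizer H c x" using ex_trs_minimizer by blast
  then have "d_minimizer H c (x, 0)" by (simp add: d_minimizer_0_iff assms)
  then show ?thesis using x by (simp add: trs_value_eq d_value_eq d_obj_eq)
qed

section \<open>Optimality conditions for (D) with nonzero \<open>y\<close>\<close>

lemma d_minimizer_stationary:
  fixes H :: "real^'n^'n"
  assumes sym: "transpose H = H" and min: "d_minimizer H c (x, y)" and y: "y \<noteq> 0"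
  defines "l \<equiv> min_eigenvalue H"
  shows "l \<le> 0" "H *v y = l *\<^sub>R y" "l * (x \<bullet> x + y \<bullet> y - 1) = 0" "(H - mat l) *v x + c = 0"
proof -
  have feas: "x \<bullet> x + y \<bullet> y \<le> 1"
    and opt: "\<And>u v. u \<bullet> u + v \<bullet> v \<le> 1 \<Longrightarrow> d_obj H c (x, y) \<le> d_obj H c (u, v)"
    using min by (auto simp: d_minimizer_iff)
  have yy: "0 < y \<bullet> y" using y by simp
  have Rayleigh: "l * (u \<bullet> u) \<le> u \<bullet> (H *v u)" for u
    using min_eigenvalue_Rayleigh(2)[OF sym] by (simp add: l_def)
  have "eigenvalue H l" using min_eigenvalue_Rayleigh(1)[OF sym] by (simp add: l_def)
  then obtain v where v: "v \<noteq> 0" "H *v v = l *\<^sub>R v" by (auto simp: eigenvalue_def)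
  \<comment> \<open>A rescaled eigenvector attains the Rayleigh bound at any prescribed squared norm
    \<open>r\<close>.\<close>
  have eigenvector: "\<exists>w. w \<bullet> w = r \<and> w \<bullet> (H *v w) = l * r" if "0 \<le> r" for r
  proof -
    define w where "w = sqrt (r / (v \<bullet> v)) *\<^sub>R v"
    have w: "w \<bullet> w = r"
      using v(1) that by (simp add: w_def flip: mult.assoc)
    have "H *v w = l *\<^sub>R w"
      using v(2) by (simp add: w_def matrix_vector_mult_scaleR)
    then show ?thesis using w by auto
  qed
  have "y \<bullet> (H *v y) \<le> 0" using opt[of x 0] feas yy by (simp add: d_obj_eq)
  then have "l * (y \<bullet> y) \<le> 0" using Rayleigh[of y] by linarith
  then show l: "l \<le> 0" using yy by (simp add: mult_le_0_iff)
  \<comment> \<open>Spending all the slack \<open>1 - x \<bullet> x\<close> on \<open>w\<close>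
    closes the chain \<open>l * (y \<bullet> y) \<le> y \<bullet> (H *v y) \<le> l * (1 - x
    \<bullet> x) \<le> l * (y \<bullet> y)\<close>, so equality holds throughout.\<close>
  obtain w where "w \<bullet> w = 1 - x \<bullet> x" "w \<bullet> (H *v w) = l * (1 - x \<bullet> x)"
    using eigenvector[of "1 - x \<bullet> x"] feas yy by auto
  then have "y \<bullet> (H *v y) \<le> l * (1 - x \<bullet> x)"
    using opt[of x w] by (simp add: d_obj_eq)
  moreover have "l * (1 - x \<bullet> x) \<le> l * (y \<bullet> y)"
    using feas l by (intro mult_left_mono_neg) auto
  ultimately have yHy: "y \<bullet> (H *v y) = l * (y \<bullet> y)" "l * (1 - x \<bullet> x) = l * (y \<bullet> y)"
    using Rayleigh[of y] by linarith+
  then show "l * (x \<bullet> x + y \<bullet> y - 1) = 0" by (simp add: algebra_simps)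
  have "(H - mat l) *v y = 0"
    using Rayleigh yHy(1)
    by (intro psd_inner_eq_0_imp transpose_diff_mat sym)
       (auto simp: diff_mat_vector_mult inner_simps)
  then show "H *v y = l *\<^sub>R y" by (simp add: diff_mat_vector_mult)
  have x: "norm x < 1"
    using feas yy unfolding norm_eq_sqrt_inner real_sqrt_lt_1_iff by linarith
  show "(H - mat l) *v x + c = 0"
  proof (rule trs_obj_local_min_imp_stationary[OF transpose_diff_mat[OF sym]])
    show "0 < 1 - norm x" using x by simp
    fix z assume "z \<in> ball x (1 - norm x)"
    then have "norm z < 1" using norm_triangle_ineq2[of z x] by (simp add: dist_norm norm_minus_commute)
    then have "0 \<le> 1 - z \<bullet> z" by (simp add: dot_square_norm abs_square_le_1)
    \<comment> \<open>With this \<open>w\<close>, the (D) objective at \<open>(z, w)\<close> is the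
      shifted objective at \<open>z\<close> plus \<open>l / 2\<close>; the same relation holds at
      \<open>(x, y)\<close>.\<close>
    then obtain w where w: "w \<bullet> w = 1 - z \<bullet> z" "w \<bullet> (H *v w) = l * (1 - z \<bullet> z)"
      using eigenvector by blast
    then show "trs_obj (H - mat l) c x \<le> trs_obj (H - mat l) c z"
      using opt[of z w] yHy by (simp add: d_obj_eq trs_obj_diff_mat algebra_simps)
  qed
qed

section \<open>The multiplier, the pseudoinverse and hard case (ii)\<close>

lemma lambda_star_eqI:
  assumes "0 \<le> l"
    and "\<And>x. trs_minimizer H c x \<Longrightarrow> (H + mat l) *v x + c = 0 \<and> l * (x \<bullet> x - 1) = 0"
  shows "lambda_star H c = l"
  unfolding lambda_star_def
proof (rule the_equality)
  fix k assume k: "0 \<le> k \<and> (\<forall>x. trs_minimizer H c x \<longrightarrow> (H + mat k) *v x + c = 0 \<and> k * (x \<bullet> x - 1) = 0)"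
  obtain x where x: "trs_minimizer H c x" using ex_trs_minimizer by blast
  have "(H + mat k) *v x + c = (H + mat l) *v x + c" "k * (x \<bullet> x - 1) = 0" "l * (x \<bullet> x - 1) = 0"
    using assms(2)[OF x] k x by auto
  \<comment> \<open>If \<open>x = 0\<close>, complementarity makes both multipliers zero; otherwise
    \<open>k *\<^sub>R x = l *\<^sub>R x\<close> makes them equal.\<close>
  then show "k = l" by (auto simp: add_mat_vector_mult)
qed (use assms in auto)

text \<open>\<open>pseudoinverse A ** A\<close> is symmetric and idempotent, hence an orthogonal
  projection, which cannot increase norms. It bounds the pseudoinverse solution by any other
  solution.\<close>

lemma norm_pseudoinverse_mult_le:
  fixes A :: "real^'n^'m"
  shows "norm (pseudoinverse A *v (A *v x)) \<le> norm x"
proof -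
  define P where "P = pseudoinverse A ** A"
  have "transpose P = P" "P ** P = P"
    using is_pseudoinverse_pseudoinverse[of A]
    by (auto simp: P_def is_pseudoinverse_def matrix_mul_assoc)
  then have "(P *v x) \<bullet> (P *v x) = x \<bullet> (P *v x)"
    by (metis symmetric_inner_commute matrix_vector_mul_assoc)
  then have "norm (P *v x) * norm (P *v x) \<le> norm x * norm (P *v x)"
    by (metis norm_cauchy_schwarz norm_eq_square dot_square_norm power2_eq_square)
  then show ?thesis
    by (cases "P *v x = 0") (auto simp: P_def matrix_vector_mul_assoc)
qed

lemma hard_case_ii_of_d_minimizer:
  fixes H :: "real^'n^'n"
  assumes sym: "transpose H = H" and min: "d_minimizer H c (x, y)" and y: "y \<noteq> 0"
  shows "hard_case_ii H c"
proof -
  define l where "l = min_eigenvalue H"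
  define M where "M = H - mat l"
  note stat = d_minimizer_stationary[OF assms, folded l_def]
  have symM: "transpose M = M" unfolding M_def by (rule transpose_diff_mat[OF sym])
  have grad: "M *v x + c = 0" using stat(4) by (simp add: M_def)
  then have c: "c = M *v (- x)"
    by (simp add: linear_neg[OF matrix_vector_mul_linear] eq_neg_iff_add_eq_0 add.commute)
  have psd: "0 \<le> z \<bullet> (M *v z)" for z
    using min_eigenvalue_Rayleigh(2)[OF sym, of z]
    by (simp add: M_def l_def diff_mat_vector_mult inner_simps)
  have convex: "trs_obj M c x \<le> trs_obj M c z" for z
    using trs_obj_add_scaleR[OF symM, of c x 1 "z - x"] grad psd[of "z - x"] by simp
  have "lambda_star H c = - l"
  proof (rule lambda_star_eqI)
    show "0 \<le> - l" using stat(1) by simp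
    fix z assume z: "trs_minimizer H c z"
    have "trs_obj H c z = d_obj H c (x, y)"
      using trs_value_eq[OF z] d_value_eq[OF min] trs_value_eq_d_value[OF sym] by simp
    also have "\<dots> = trs_obj M c x + 1/2 * l"
      using stat(2,3) by (simp add: d_obj_eq M_def trs_obj_diff_mat algebra_simps)
    finally have eq: "trs_obj M c z + 1/2 * l * (z \<bullet> z) = trs_obj M c x + 1/2 * l"
      by (simp add: M_def trs_obj_diff_mat)
    have "z \<bullet> z \<le> 1" using z by (simp add: trs_minimizer_iff)
    \<comment> \<open>In \<open>eq\<close>, neither summand on the left is below its counterpart on
      the right, so both agree; \<open>z\<close> thus also minimizes the convex shifted
      objective.\<close>
    then have "l * 1 \<le> l * (z \<bullet> z)" using stat(1) by (intro mult_left_mono_neg)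
    then have tight: "l * (z \<bullet> z) = l" "trs_obj M c z = trs_obj M c x"
      using eq convex[of z] by linarith+
    have "M *v z + c = 0"
      by (rule trs_obj_local_min_imp_stationary[OF symM zero_less_one]) (simp add: tight(2) convex)
    then show "(H + mat (- l)) *v z + c = 0 \<and> - l * (z \<bullet> z - 1) = 0"
      using tight(1) by (simp add: M_def add_mat_vector_mult diff_mat_vector_mult right_diff_distrib)
  qed
  moreover have "c \<in> span (columns M)"
    unfolding c by (rule matrix_vector_mult_in_columnspace)
  moreover have "norm (pseudoinverse M *v c) < 1"
  proof -
    have "norm (pseudoinverse M *v c) \<le> norm x"
      using norm_pseudoinverse_mult_le[of M "- x"] by (simp add: c)
    also have "\<dots> < 1"
    proof -
      have "0 < y \<bullet> y" "x \<bullet> x + y \<bullet> y \<le> 1" using min y by (auto simp: d_minimizer_iff)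
      then show ?thesis unfolding norm_eq_sqrt_inner real_sqrt_lt_1_iff by linarith
    qed
    finally show ?thesis .
  qed
  ultimately show ?thesis by (simp add: hard_case_ii_def M_def l_def)
qed

section \<open>Recovering a minimizer of (TRS) from one of (D)\<close>

lemma trs_minimizer_of_d_minimizer:
  fixes H :: "real^'n^'n"
  assumes sym: "transpose H = H" and min: "d_minimizer H c (x, y)" and y: "y \<noteq> 0"
    and unit: "(x + t *\<^sub>R y) \<bullet> (x + t *\<^sub>R y) = 1"
  shows "trs_minimizer H c (x + t *\<^sub>R y)"
proof -
  define l where "l = min_eigenvalue H"
  note stat = d_minimizer_stationary[OF sym min y, folded l_def]
  \<comment> \<open>The shifted gradient vanishes at \<open>x\<close> and \<open>H - mat l\<close>
    annihilates \<open>y\<close>, so the shifted objective is constant along the line.\<close>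
  have "trs_obj (H - mat l) c (x + t *\<^sub>R y) = trs_obj (H - mat l) c x"
    using stat(2,4) by (simp add: trs_obj_add_scaleR[OF transpose_diff_mat[OF sym]] diff_mat_vector_mult)
  then have "trs_obj H c (x + t *\<^sub>R y) = d_obj H c (x, y)"
    using stat(2,3) by (simp add: trs_obj_diff_mat unit d_obj_eq right_diff_distrib distrib_left)
  then show ?thesis
    using unit min d_obj_eq[of H c _ 0] unfolding trs_minimizer_iff d_minimizer_iff
    by (metis add.right_neutral inner_zero_left mult_zero_right order_refl)
qed

theorem theorem3p2:
  fixes H :: "real^'n^'n" and c :: "real^'n"
  assumes "transpose H = H"
  shows "trs_value H c = d_value H c \<and>
    (\<forall>x y. d_minimizer H c (x, y) \<longrightarrow>
      (y = 0 \<longrightarrow> trs_minimizer H c x) \<and>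
      (y \<noteq> 0 \<longrightarrow> hard_case_ii H c \<and>
        trs_minimizer H c
          (x + ((sqrt ((x \<bullet> y)\<^sup>2 + (y \<bullet> y) * (1 - x \<bullet> x)) - x \<bullet> y) / (y \<bullet> y)) *\<^sub>R y)))"
proof (intro conjI allI impI)
  show "trs_value H c = d_value H c" by (rule trs_value_eq_d_value[OF assms])
next
  fix x y assume "d_minimizer H c (x, y)" "y = 0"
  then show "trs_minimizer H c x" by (simp add: d_minimizer_0_iff assms)
next
  fix x y assume "d_minimizer H c (x, y)" "y \<noteq> 0"
  then show "hard_case_ii H c" by (rule hard_case_ii_of_d_minimizer[OF assms])
next
  fix x y assume min: "d_minimizer H c (x, y)" and y: "y \<noteq> 0"
  define s where "s = sqrt ((x \<bullet> y)\<^sup>2 + (y \<bullet> y) * (1 - x \<bullet> x))"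
  define t where "t = (s - x \<bullet> y) / (y \<bullet> y)"
  have yy: "0 < y \<bullet> y" using y by simp
  have "0 \<le> 1 - x \<bullet> x" using min yy unfolding d_minimizer_iff by linarith
  then have s: "s\<^sup>2 = (x \<bullet> y)\<^sup>2 + (y \<bullet> y) * (1 - x \<bullet> x)" by (simp add: s_def)
  have ty: "t * (y \<bullet> y) = s - x \<bullet> y" using yy by (simp add: t_def)
  \<comment> \<open>Multiplying by \<open>y \<bullet> y\<close> completes the square, whose root
    \<open>t * (y \<bullet> y) + x \<bullet> y\<close> is \<open>s\<close>.\<close>
  have "(y \<bullet> y) * ((x + t *\<^sub>R y) \<bullet> (x + t *\<^sub>R y)) = (y \<bullet> y) * (x \<bullet> x) + (t * (y \<bullet> y) + x \<bullet> y)\<^sup>2 - (x \<bullet> y)\<^sup>2"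
    by (simp add: inner_simps inner_commute power2_eq_square algebra_simps)
  also have "\<dots> = (y \<bullet> y) * 1" by (simp add: ty s algebra_simps)
  finally have "(x + t *\<^sub>R y) \<bullet> (x + t *\<^sub>R y) = 1" using yy by simp
  then show "trs_minimizer H c
    (x + ((sqrt ((x \<bullet> y)\<^sup>2 + (y \<bullet> y) * (1 - x \<bullet> x)) - x \<bullet> y) / (y \<bullet> y)) *\<^sub>R y)"
    using trs_minimizer_of_d_minimizer[OF assms min y] by (simp add: t_def s_def)
qed

end
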